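(* Let $\mathcal{S}$ be a semiring. Then the following are equivalent: (i) for every $m\in\mathbb{N}$, the Ehrenfeucht–Fraïssé game $G_m$ is sound for $\equiv_m$ on $\mathcal{S}$, i.e. for all model-defining $\mathcal{S}$-interpretations $\pi_A,\pi_B$ (of the same finite relational vocabulary), if Duplicator has a winning strategy in $G_m(\pi_A,\pi_B)$ then $\pi_A\equiv_m\pi_B$; (ii) $\mathcal{S}$ is fully idempotent, i.e. $s+s=s$ and $s\cdot s=s$ for all $s\in\mathcal{S}$.
   Context: A semiring is a structure $\mathcal{S}=(S,+,\cdot,0,1)$ with $0\neq 1$ such that $(S,+,0)$ and $(S,\cdot,1)$ are commutative monoids, $\cdot$ distributes over $+$, $0\cdot s=0$, and which is naturally ordered, i.e. $s\le t:\Leftrightarrow\exists r\,(s+r=t)$ is a partial order. Let $\tau$ be a finite relational vocabulary. For a universe $A$ (here finite), $\mathrm{Lit}_A(\tau)$ is the set of literals $R\bar a$ and $\neg R\bar a$ with $R\in\tau$ and $\bar a$ a tuple from $A$. An $\mathcal{S}$-interpretation is a map $\pi:\mathrm{Lit}_A(\tau)\to S$; it is model-defining if for every atom $R\bar a$ exactly one of $\pi(R\bar a),\pi(\neg R\bar a)$ is $0$. First-order formulae are taken in negation normal form and evaluated by: $\pi[\![a=a]\!]=1$, $\pi[\![a=b]\!]=0$ for $a\ne b$ (dually for $\neq$), literals by $\pi$, $\vee$ by $+$, $\wedge$ by $\cdot$, $\exists x$ by $\sum_{a\in A}$ and $\forall x$ by $\prod_{a\in A}$. $(\pi_A,\bar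 a)\equiv_m(\pi_B,\bar b)$ means $\pi_A[\![\varphi(\bar a)]\!]=\pi_B[\![\varphi(\bar b)]\!]$ for all formulae $\varphi(\bar x)$ of quantifier rank at most $m$. The game $G_m(\pi_A,\bar a,\pi_B,\bar b)$: in each of $m$ rounds Spoiler picks an element of $A$ or of $B$ and Duplicator answers with an element of the other universe; with the resulting tuples $\bar a',\bar b'$ (initial tuples extended by the picks, of length $k$), Duplicator wins iff the map $\bar a'\mapsto\bar b'$ is a local isomorphism: $a'_i=a'_j\Leftrightarrow b'_i=b'_j$ for all $i,j$, and $\pi_A(L(\bar a'))=\pi_B(L(\bar b'))$ for all literals $L(x_1,\dots,x_k)$ over $\tau$. $G_m(\pi_A,\pi_B)$ starts with empty tuples. *)

theory Defs
  imports Main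
begin

text \<open>
  Semirings in the intended sense are the types of sort
  \<open>{comm_semiring_1, canonically_ordered_monoid_add}\<close>: the axiom \<open>le_iff_add\<close> of the latter
  class makes \<open>\<le>\<close> the natural order, and its superclass \<^class>\<open>order\<close> makes it a partial order.

  A finite relational vocabulary is a finite partial map from relation symbols to arities.
\<close>

type_synonym 'r vocabulary = "'r \<rightharpoonup> nat"

datatype (dead 'r, 'v) literal = Pos 'r "'v list" | Neg 'r "'v list"

text \<open>
  \<open>Lit \<tau> A\<close> is the set of literals over the universe \<open>A\<close>; with a set of variables in place of
  \<open>A\<close> it is the set of literals in these variables.
\<close>

definition Lit :: "'r vocabulary \<Rightarrow> 'v set \<Rightarrow> ('r, 'v) literal set" where
  "Lit \<tau> A =
     {Pos R as | R as. \<tau> R = Some (length as) \<and> set as \<subseteq> A} \<union>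
     {Neg R as | R as. \<tau> R = Some (length as) \<and> set as \<subseteq> A}"

text \<open>
  Interpretations are total functions, of which only the values on \<open>Lit \<tau> A\<close> are relevant.
\<close>

type_synonym ('r, 'a, 's) interp = "('r, 'a) literal \<Rightarrow> 's"

definition model_defining ::
  "'r vocabulary \<Rightarrow> 'a set \<Rightarrow> ('r, 'a, 's::zero) interp \<Rightarrow> bool" where
  "model_defining \<tau> A \<pi> \<longleftrightarrow>
     (\<forall>R as. \<tau> R = Some (length as) \<and> set as \<subseteq> A \<longrightarrow>
        (\<pi> (Pos R as) = 0 \<and> \<pi> (Neg R as) \<noteq> 0) \<or> (\<pi> (Pos R as) \<noteq> 0 \<and> \<pi> (Neg R as) = 0))"

datatype 'r formula =
    Eq nat nat
  | Neq nat nat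
  | Literal "('r, nat) literal"
  | Or "'r formula" "'r formula"
  | And "'r formula" "'r formula"
  | Exists nat "'r formula"
  | Forall nat "'r formula"

primrec formula_over :: "'r vocabulary \<Rightarrow> 'r formula \<Rightarrow> bool" where
  "formula_over \<tau> (Eq x y) \<longleftrightarrow> True"
| "formula_over \<tau> (Neq x y) \<longleftrightarrow> True"
| "formula_over \<tau> (Literal L) \<longleftrightarrow> L \<in> Lit \<tau> UNIV"
| "formula_over \<tau> (Or \<phi> \<psi>) \<longleftrightarrow> formula_over \<tau> \<phi> \<and> formula_over \<tau> \<psi>"
| "formula_over \<tau> (And \<phi> \<psi>) \<longleftrightarrow> formula_over \<tau> \<phi> \<and> formula_over \<tau> \<psi>"
| "formula_over \<tau> (Exists x \<phi>) \<longleftrightarrow> formula_over \<tau> \<phi>"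
| "formula_over \<tau> (Forall x \<phi>) \<longleftrightarrow> formula_over \<tau> \<phi>"

primrec free_vars :: "'r formula \<Rightarrow> nat set" where
  "free_vars (Eq x y) = {x, y}"
| "free_vars (Neq x y) = {x, y}"
| "free_vars (Literal L) = set_literal L"
| "free_vars (Or \<phi> \<psi>) = free_vars \<phi> \<union> free_vars \<psi>"
| "free_vars (And \<phi> \<psi>) = free_vars \<phi> \<union> free_vars \<psi>"
| "free_vars (Exists x \<phi>) = free_vars \<phi> - {x}"
| "free_vars (Forall x \<phi>) = free_vars \<phi> - {x}"

primrec quantifier_rank :: "'r formula \<Rightarrow> nat" where
  "quantifier_rank (Eq x y) = 0"
| "quantifier_rank (Neq x y) = 0"
| "quantifier_rank (Literal L) = 0"
| "quantifier_rank (Or \<phi> \<psi>) = max (quantifier_rank \<phi>) (quantifier_rank \<psi>)"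
| "quantifier_rank (And \<phi> \<psi>) = max (quantifier_rank \<phi>) (quantifier_rank \<psi>)"
| "quantifier_rank (Exists x \<phi>) = Suc (quantifier_rank \<phi>)"
| "quantifier_rank (Forall x \<phi>) = Suc (quantifier_rank \<phi>)"

primrec eval ::
  "'a set \<Rightarrow> ('r, 'a, 's::comm_semiring_1) interp \<Rightarrow> (nat \<Rightarrow> 'a) \<Rightarrow> 'r formula \<Rightarrow> 's" where
  "eval A \<pi> \<sigma> (Eq x y) = (if \<sigma> x = \<sigma> y then 1 else 0)"
| "eval A \<pi> \<sigma> (Neq x y) = (if \<sigma> x = \<sigma> y then 0 else 1)"
| "eval A \<pi> \<sigma> (Literal L) = \<pi> (map_literal \<sigma> L)"
| "eval A \<pi> \<sigma> (Or \<phi> \<psi>) = eval A \<pi> \<sigma> \<phi> + eval A \<pi> \<sigma> \<psi>"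
| "eval A \<pi> \<sigma> (And \<phi> \<psi>) = eval A \<pi> \<sigma> \<phi> * eval A \<pi> \<sigma> \<psi>"
| "eval A \<pi> \<sigma> (Exists x \<phi>) = (\<Sum>a\<in>A. eval A \<pi> (\<sigma>(x := a)) \<phi>)"
| "eval A \<pi> \<sigma> (Forall x \<phi>) = (\<Prod>a\<in>A. eval A \<pi> (\<sigma>(x := a)) \<phi>)"

text \<open>
  The free variables of a formula evaluated at a tuple \<open>as\<close> are among \<open>0, \<dots>, length as - 1\<close>,
  and variable \<open>i\<close> denotes \<open>as ! i\<close>; for the empty tuple the formulae are the sentences.
\<close>

definition equiv_rank ::
  "'r vocabulary \<Rightarrow> nat \<Rightarrow>
   'a set \<Rightarrow> ('r, 'a, 's::comm_semiring_1) interp \<Rightarrow> 'a list \<Rightarrow>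
   'b set \<Rightarrow> ('r, 'b, 's) interp \<Rightarrow> 'b list \<Rightarrow> bool" where
  "equiv_rank \<tau> m A \<pi>\<^sub>A as B \<pi>\<^sub>B bs \<longleftrightarrow>
     length as = length bs \<and>
     (\<forall>\<phi>. formula_over \<tau> \<phi> \<and> free_vars \<phi> \<subseteq> {..<length as} \<and> quantifier_rank \<phi> \<le> m \<longrightarrow>
        eval A \<pi>\<^sub>A (\<lambda>i. as ! i) \<phi> = eval B \<pi>\<^sub>B (\<lambda>i. bs ! i) \<phi>)"

definition local_isomorphism ::
  "'r vocabulary \<Rightarrow>
   ('r, 'a, 's) interp \<Rightarrow> 'a list \<Rightarrow> ('r, 'b, 's) interp \<Rightarrow> 'b list \<Rightarrow> bool" where
  "local_isomorphism \<tau> \<pi>\<^sub>A as \<pi>\<^sub>B bs \<longleftrightarrow>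
     length as = length bs \<and>
     (\<forall>i<length as. \<forall>j<length as. as ! i = as ! j \<longleftrightarrow> bs ! i = bs ! j) \<and>
     (\<forall>L \<in> Lit \<tau> {..<length as}.
        \<pi>\<^sub>A (map_literal (\<lambda>i. as ! i) L) = \<pi>\<^sub>B (map_literal (\<lambda>i. bs ! i) L))"

text \<open>
  Spoiler's move \<open>Inl a\<close> picks \<open>a\<close> in the first universe, \<open>Inr b\<close> picks \<open>b\<close> in the second.
  A strategy for Duplicator consists of \<open>f\<close>, which answers picks in the first universe, and \<open>g\<close>,
  which answers picks in the second one. Both may depend on the list \<open>h\<close> of all earlier moves of
  Spoiler, which together with the strategy determines the whole history of the play.
  \<open>play f g h ms\<close> is the list of pairs picked in the rounds in which Spoiler, after the moves
  \<open>h\<close>, plays \<open>ms\<close>.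
\<close>

primrec play ::
  "(('a + 'b) list \<Rightarrow> 'a \<Rightarrow> 'b) \<Rightarrow> (('a + 'b) list \<Rightarrow> 'b \<Rightarrow> 'a) \<Rightarrow>
   ('a + 'b) list \<Rightarrow> ('a + 'b) list \<Rightarrow> ('a \<times> 'b) list" where
  "play f g h [] = []"
| "play f g h (s # ms) =
     (case s of Inl a \<Rightarrow> (a, f h a) | Inr b \<Rightarrow> (g h b, b)) # play f g (h @ [s]) ms"

definition winning_strategy ::
  "'r vocabulary \<Rightarrow> nat \<Rightarrow>
   'a set \<Rightarrow> ('r, 'a, 's) interp \<Rightarrow> 'a list \<Rightarrow>
   'b set \<Rightarrow> ('r, 'b, 's) interp \<Rightarrow> 'b list \<Rightarrow>
   (('a + 'b) list \<Rightarrow> 'a \<Rightarrow> 'b) \<Rightarrow> (('a + 'b) list \<Rightarrow> 'b \<Rightarrow> 'a) \<Rightarrow> bool" where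
  "winning_strategy \<tau> m A \<pi>\<^sub>A as B \<pi>\<^sub>B bs f g \<longleftrightarrow>
     (\<forall>h. set h \<subseteq> A <+> B \<and> length h < m \<longrightarrow> (\<forall>a\<in>A. f h a \<in> B) \<and> (\<forall>b\<in>B. g h b \<in> A)) \<and>
     (\<forall>ms. set ms \<subseteq> A <+> B \<and> length ms = m \<longrightarrow>
        local_isomorphism \<tau>
          \<pi>\<^sub>A (as @ map fst (play f g [] ms))
          \<pi>\<^sub>B (bs @ map snd (play f g [] ms)))"

definition duplicator_wins ::
  "'r vocabulary \<Rightarrow> nat \<Rightarrow>
   'a set \<Rightarrow> ('r, 'a, 's) interp \<Rightarrow> 'a list \<Rightarrow>
   'b set \<Rightarrow> ('r, 'b, 's) interp \<Rightarrow> 'b list \<Rightarrow> bool" where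
  "duplicator_wins \<tau> m A \<pi>\<^sub>A as B \<pi>\<^sub>B bs \<longleftrightarrow>
     (\<exists>f g. winning_strategy \<tau> m A \<pi>\<^sub>A as B \<pi>\<^sub>B bs f g)"

end

theory Submission
  imports Defs
begin

text \<open>
  If both operations are idempotent, a sum or product over a universe depends only on the set of
  values taken. One round of back-and-forth makes these sets equal, so the values of
  quantified formulae agree by induction on the formula.
  Conversely, a single round cannot tell a one-element universe from a two-element one when every
  \<open>R a\<close> has the same value \<open>s \<noteq> 0\<close>; the sentences \<open>\<exists>x. R x\<close> and \<open>\<forall>x. R x\<close> then force \<open>s = s + s\<close>
  and \<open>s = s * s\<close>.
\<close>

text \<open>A repeated value is absorbed by its other occurrence. Working in the locale serves both
  the sums of existential and the products of universal quantifiers.\<close>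

lemma (in comm_monoid_set) eq_image_of_idem:
  assumes idem: "\<And>x. x \<^bold>* x = x" and "finite A"
  shows "F h A = F id (h ` A)"
  using \<open>finite A\<close>
proof (induction A rule: finite_induct)
  case (insert a A)
  show ?case
  proof (cases "h a \<in> h ` A")
    case True
    \<comment> \<open>Splitting off the value \<open>h a\<close>, which already occurs, exposes the
      factor that absorbs the new \<open>h a\<close>.\<close>
    have "F id (h ` A) = h a \<^bold>* F id (h ` A - {h a})"
      using True insert.hyps by (simp add: remove)
    moreover have "h a \<^bold>* F id (h ` A) = F id (h ` A)"
      unfolding calculation by (metis assoc idem)
    ultimately show ?thesis
      using True insert by (simp add: insert_absorb)
  qed (use insert in simp)
qed simp

text \<open>The winning condition concerns final tuples only; this carries it back to earlier ones.
  Equal lengths ensure that positions of \<open>as\<close> index \<open>bs\<close> and not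
  \<open>bs'\<close>.\<close>

lemma local_isomorphism_prefix:
  assumes "local_isomorphism \<tau> \<pi>\<^sub>A (as @ as') \<pi>\<^sub>B (bs @ bs')" and len: "length as = length bs"
  shows "local_isomorphism \<tau> \<pi>\<^sub>A as \<pi>\<^sub>B bs"
proof -
  have nth: "(as @ as') ! i = as ! i" "(bs @ bs') ! i = bs ! i" if "i < length as" for i
    using that len by (simp_all add: nth_append)
  have "\<pi>\<^sub>A (map_literal ((!) as) L) = \<pi>\<^sub>B (map_literal ((!) bs) L)"
    if L: "L \<in> Lit \<tau> {..<length as}" for L
  proof -
    have vars: "set_literal L \<subseteq> {..<length as}"
      using L by (auto simp: Lit_def)
    have "L \<in> Lit \<tau> {..<length (as @ as')}"
      using L by (fastforce simp: Lit_def)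
    then have "\<pi>\<^sub>A (map_literal ((!) (as @ as')) L) = \<pi>\<^sub>B (map_literal ((!) (bs @ bs')) L)"
      using assms(1) unfolding local_isomorphism_def by blast
    moreover have "map_literal ((!) (as @ as')) L = map_literal ((!) as) L"
      using vars nth by (intro literal.map_cong) auto
    moreover have "map_literal ((!) (bs @ bs')) L = map_literal ((!) bs) L"
      using vars nth by (intro literal.map_cong) auto
    ultimately show ?thesis by simp
  qed
  moreover have "as ! i = as ! j \<longleftrightarrow> bs ! i = bs ! j" if "i < length as" "j < length as" for i j
  proof -
    have "(as @ as') ! i = (as @ as') ! j \<longleftrightarrow> (bs @ bs') ! i = (bs @ bs') ! j"
      using assms(1) that by (simp add: local_isomorphism_def)
    then show ?thesis using nth that by simp
  qed
  ultimately show ?thesis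
    using len by (simp add: local_isomorphism_def)
qed

text \<open>\<open>play\<close> appends moves to the history, whereas
  \<open>winning_strategy\<close> starts from the empty one; absorbing the first move into the
  strategy reconciles the two.\<close>

lemma play_Cons_history:
  "play f g (s # h) ms = play (\<lambda>h. f (s # h)) (\<lambda>h. g (s # h)) h ms"
  by (induction ms arbitrary: h) simp_all

text \<open>Prefixing \<open>s\<close> to every history works because each play of the remaining
  game is the tail of an original play opened by \<open>s\<close>.\<close>

lemma winning_strategy_after_move:
  assumes win: "winning_strategy \<tau> (Suc m) A \<pi>\<^sub>A as B \<pi>\<^sub>B bs f g" and s: "s \<in> A <+> B"
    and ab: "(a, b) = (case s of Inl a \<Rightarrow> (a, f [] a) | Inr b \<Rightarrow> (g [] b, b))"
  shows "winning_strategy \<tau> m A \<pi>\<^sub>A (as @ [a]) B \<pi>\<^sub>B (bs @ [b]) (\<lambda>h. f (s # h)) (\<lambda>h. g (s # h))"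
  unfolding winning_strategy_def
proof (intro conjI allI impI)
  fix h assume "set h \<subseteq> A <+> B \<and> length h < m"
  then have "set (s # h) \<subseteq> A <+> B \<and> length (s # h) < Suc m"
    using s by simp
  then show "\<forall>a\<in>A. f (s # h) a \<in> B" and "\<forall>b\<in>B. g (s # h) b \<in> A"
    using win unfolding winning_strategy_def by blast+
next
  fix ms assume "set ms \<subseteq> A <+> B \<and> length ms = m"
  then have "set (s # ms) \<subseteq> A <+> B \<and> length (s # ms) = Suc m"
    using s by simp
  then have "local_isomorphism \<tau> \<pi>\<^sub>A (as @ map fst (play f g [] (s # ms)))
      \<pi>\<^sub>B (bs @ map snd (play f g [] (s # ms)))"
    using win unfolding winning_strategy_def by blast
  then show "local_isomorphism \<tau>
      \<pi>\<^sub>A ((as @ [a]) @ map fst (play (\<lambda>h. f (s # h)) (\<lambda>h. g (s # h)) [] ms))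
      \<pi>\<^sub>B ((bs @ [b]) @ map snd (play (\<lambda>h. f (s # h)) (\<lambda>h. g (s # h)) [] ms))"
    by (simp add: play_Cons_history flip: ab)
qed

text \<open>The answer is \<open>f [] a\<close>. This and its mirror image
  \<open>duplicator_wins_back\<close> replace strategies by back-and-forth conditions in the
  induction on formulae.\<close>

lemma duplicator_wins_forth:
  assumes "duplicator_wins \<tau> (Suc m) A \<pi>\<^sub>A as B \<pi>\<^sub>B bs" and "a \<in> A"
  shows "\<exists>b\<in>B. duplicator_wins \<tau> m A \<pi>\<^sub>A (as @ [a]) B \<pi>\<^sub>B (bs @ [b])"
proof -
  from assms(1) obtain f g where win: "winning_strategy \<tau> (Suc m) A \<pi>\<^sub>A as B \<pi>\<^sub>B bs f g"
    unfolding duplicator_wins_def by blast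
  then have "f [] a \<in> B"
    using \<open>a \<in> A\<close> by (simp add: winning_strategy_def)
  with winning_strategy_after_move[OF win, of "Inl a"] show ?thesis
    using \<open>a \<in> A\<close> unfolding duplicator_wins_def by auto
qed

lemma duplicator_wins_back:
  assumes "duplicator_wins \<tau> (Suc m) A \<pi>\<^sub>A as B \<pi>\<^sub>B bs" and "b \<in> B"
  shows "\<exists>a\<in>A. duplicator_wins \<tau> m A \<pi>\<^sub>A (as @ [a]) B \<pi>\<^sub>B (bs @ [b])"
proof -
  from assms(1) obtain f g where win: "winning_strategy \<tau> (Suc m) A \<pi>\<^sub>A as B \<pi>\<^sub>B bs f g"
    unfolding duplicator_wins_def by blast
  then have "g [] b \<in> A"
    using \<open>b \<in> B\<close> by (simp add: winning_strategy_def)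
  with winning_strategy_after_move[OF win, of "Inr b"] show ?thesis
    using \<open>b \<in> B\<close> unfolding duplicator_wins_def by auto
qed

text \<open>One complete legal play suffices: Spoiler repeats a single element of \<open>A\<close>,
  which exists by nonemptiness.\<close>

lemma duplicator_wins_imp_local_isomorphism:
  assumes "duplicator_wins \<tau> m A \<pi>\<^sub>A as B \<pi>\<^sub>B bs" and "A \<noteq> {}" and "length as = length bs"
  shows "local_isomorphism \<tau> \<pi>\<^sub>A as \<pi>\<^sub>B bs"
proof -
  obtain a where "a \<in> A" using \<open>A \<noteq> {}\<close> by blast
  then have "set (replicate m (Inl a)) \<subseteq> A <+> B \<and> length (replicate m (Inl a)) = m"
    by auto
  with assms(1) show ?thesis
    unfolding duplicator_wins_def winning_strategy_def
    by (metis local_isomorphism_prefix[OF _ assms(3)])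
qed

text \<open>
  The map \<open>p\<close> sends a variable to the round in which its value was picked. It is needed because
  variables can be requantified, whereas picks are only ever appended.
\<close>

lemma eval_eq_if_duplicator_wins:
  fixes \<pi>\<^sub>A :: "('r, 'a, 's::comm_semiring_1) interp" and \<pi>\<^sub>B :: "('r, 'b, 's) interp"
  assumes idem: "\<And>s :: 's. s + s = s" "\<And>s :: 's. s * s = s"
    and fin: "finite A" "finite B" and "A \<noteq> {}"
    and "duplicator_wins \<tau> m A \<pi>\<^sub>A as B \<pi>\<^sub>B bs" "length as = length bs"
    and "formula_over \<tau> \<phi>" "quantifier_rank \<phi> \<le> m"
    and "\<And>x. x \<in> free_vars \<phi> \<Longrightarrow> p x < length as \<and> \<sigma> x = as ! p x \<and> \<rho> x = bs ! p x"
  shows "eval A \<pi>\<^sub>A \<sigma> \<phi> = eval B \<pi>\<^sub>B \<rho> \<phi>"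
  using assms(6-)
proof (induction \<phi> arbitrary: m as bs p \<sigma> \<rho>)
  case (Eq x y)
  \<comment> \<open>The rank is only bounded by \<open>m\<close>, so rounds may be left when an atom
    is reached; they are discarded here.\<close>
  then have "local_isomorphism \<tau> \<pi>\<^sub>A as \<pi>\<^sub>B bs"
    by (intro duplicator_wins_imp_local_isomorphism[OF _ \<open>A \<noteq> {}\<close>])
  then show ?case
    using Eq.prems(5)[of x] Eq.prems(5)[of y] by (simp add: local_isomorphism_def)
next
  case (Neq x y)
  then have "local_isomorphism \<tau> \<pi>\<^sub>A as \<pi>\<^sub>B bs"
    by (intro duplicator_wins_imp_local_isomorphism[OF _ \<open>A \<noteq> {}\<close>])
  then show ?case
    using Neq.prems(5)[of x] Neq.prems(5)[of y] by (simp add: local_isomorphism_def)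
next
  case (Literal L)
  then have iso: "local_isomorphism \<tau> \<pi>\<^sub>A as \<pi>\<^sub>B bs"
    by (intro duplicator_wins_imp_local_isomorphism[OF _ \<open>A \<noteq> {}\<close>])
  have vars: "p x < length as \<and> \<sigma> x = as ! p x \<and> \<rho> x = bs ! p x" if "x \<in> set_literal L" for x
    using Literal.prems(5) that by simp
  \<comment> \<open>\<open>local_isomorphism\<close> speaks of literals in positions of the tuples,
    so variables are renamed by \<open>p\<close>.\<close>
  have "map_literal p L \<in> Lit \<tau> {..<length as}"
    using Literal.prems(3) vars by (cases L) (auto simp: Lit_def)
  then have "\<pi>\<^sub>A (map_literal ((!) as) (map_literal p L)) = \<pi>\<^sub>B (map_literal ((!) bs) (map_literal p L))"
    using iso by (simp add: local_isomorphism_def)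
  moreover have "map_literal ((!) as) (map_literal p L) = map_literal \<sigma> L"
    unfolding literal.map_comp using vars by (intro literal.map_cong) auto
  moreover have "map_literal ((!) bs) (map_literal p L) = map_literal \<rho> L"
    unfolding literal.map_comp using vars by (intro literal.map_cong) auto
  ultimately show ?case by simp
next
  case (Or \<phi> \<psi>)
  have "eval A \<pi>\<^sub>A \<sigma> \<phi> = eval B \<pi>\<^sub>B \<rho> \<phi>"
    by (rule Or.IH(1)[OF Or.prems(1,2)]) (use Or.prems(3-) in auto)
  moreover have "eval A \<pi>\<^sub>A \<sigma> \<psi> = eval B \<pi>\<^sub>B \<rho> \<psi>"
    by (rule Or.IH(2)[OF Or.prems(1,2)]) (use Or.prems(3-) in auto)
  ultimately show ?case by simp
next
  case (And \<phi> \<psi>)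
  have "eval A \<pi>\<^sub>A \<sigma> \<phi> = eval B \<pi>\<^sub>B \<rho> \<phi>"
    by (rule And.IH(1)[OF And.prems(1,2)]) (use And.prems(3-) in auto)
  moreover have "eval A \<pi>\<^sub>A \<sigma> \<psi> = eval B \<pi>\<^sub>B \<rho> \<psi>"
    by (rule And.IH(2)[OF And.prems(1,2)]) (use And.prems(3-) in auto)
  ultimately show ?case by simp
next
  case (Exists x \<phi>)
  then obtain n where m: "m = Suc n" "quantifier_rank \<phi> \<le> n"
    by (cases m) auto
  \<comment> \<open>The new pick is appended at index \<open>length as\<close>, so \<open>x\<close>
    is redirected there; all other variables keep their positions.\<close>
  have eval_eq: "eval A \<pi>\<^sub>A (\<sigma>(x := a)) \<phi> = eval B \<pi>\<^sub>B (\<rho>(x := b)) \<phi>"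
    if "duplicator_wins \<tau> n A \<pi>\<^sub>A (as @ [a]) B \<pi>\<^sub>B (bs @ [b])" for a b
    by (rule Exists.IH[OF that, where p = "p(x := length as)"])
      (use Exists.prems(2-) m(2) in \<open>auto simp: nth_append less_Suc_eq\<close>)
  \<comment> \<open>Forth gives one inclusion and back the other; by idempotence the multiplicities
    of the values are irrelevant.\<close>
  have "(\<lambda>a. eval A \<pi>\<^sub>A (\<sigma>(x := a)) \<phi>) ` A = (\<lambda>b. eval B \<pi>\<^sub>B (\<rho>(x := b)) \<phi>) ` B"
    using duplicator_wins_forth[OF Exists.prems(1)[unfolded m(1)]]
      duplicator_wins_back[OF Exists.prems(1)[unfolded m(1)]] eval_eq
    unfolding set_eq_iff image_iff by metis
  then show ?case
    by (simp add: sum.eq_image_of_idem[OF idem(1), OF fin(1)] sum.eq_image_of_idem[OF idem(1), OF fin(2)])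
next
  case (Forall x \<phi>)
  then obtain n where m: "m = Suc n" "quantifier_rank \<phi> \<le> n"
    by (cases m) auto
  have eval_eq: "eval A \<pi>\<^sub>A (\<sigma>(x := a)) \<phi> = eval B \<pi>\<^sub>B (\<rho>(x := b)) \<phi>"
    if "duplicator_wins \<tau> n A \<pi>\<^sub>A (as @ [a]) B \<pi>\<^sub>B (bs @ [b])" for a b
    by (rule Forall.IH[OF that, where p = "p(x := length as)"])
      (use Forall.prems(2-) m(2) in \<open>auto simp: nth_append less_Suc_eq\<close>)
  have "(\<lambda>a. eval A \<pi>\<^sub>A (\<sigma>(x := a)) \<phi>) ` A = (\<lambda>b. eval B \<pi>\<^sub>B (\<rho>(x := b)) \<phi>) ` B"
    using duplicator_wins_forth[OF Forall.prems(1)[unfolded m(1)]]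
      duplicator_wins_back[OF Forall.prems(1)[unfolded m(1)]] eval_eq
    unfolding set_eq_iff image_iff by metis
  then show ?case
    by (simp add: prod.eq_image_of_idem[OF idem(2), OF fin(1)] prod.eq_image_of_idem[OF idem(2), OF fin(2)])
qed

text \<open>Any answer wins: the value of a literal depends on its sign alone, and one pair of picks
  makes the equality condition trivial.\<close>

lemma duplicator_wins_one_round:
  fixes r :: 'r
  assumes "A \<noteq> {}" and "B \<noteq> {}"
  shows "duplicator_wins [r \<mapsto> 1] 1 A (case_literal (\<lambda>_ _. s) (\<lambda>_ _. t)) []
    B (case_literal (\<lambda>_ _. s) (\<lambda>_ _. t)) []"
proof -
  obtain a b where "a \<in> A" "b \<in> B"
    using assms by blast
  moreover have "(case map_literal \<sigma> L of Pos _ _ \<Rightarrow> s | Neg _ _ \<Rightarrow> t) =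
      (case map_literal \<rho> L of Pos _ _ \<Rightarrow> s | Neg _ _ \<Rightarrow> t)" for L :: "('r, nat) literal" and \<sigma> \<rho>
    by (cases L) simp_all
  ultimately have "winning_strategy [r \<mapsto> 1] 1 A (case_literal (\<lambda>_ _. s) (\<lambda>_ _. t)) []
    B (case_literal (\<lambda>_ _. s) (\<lambda>_ _. t)) [] (\<lambda>_ _. b) (\<lambda>_ _. a)"
    by (auto simp: winning_strategy_def local_isomorphism_def length_Suc_conv)
  then show ?thesis
    unfolding duplicator_wins_def by blast
qed

theorem theorem3p1:
  assumes "infinite (UNIV :: 'r set)"
    and "infinite (UNIV :: 'a set)"
    and "infinite (UNIV :: 'b set)"
  shows
    "(\<forall>m :: nat. \<forall>(\<tau> :: 'r vocabulary) (A :: 'a set) (B :: 'b set)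
        (\<pi>\<^sub>A :: ('r, 'a, 's::{comm_semiring_1, canonically_ordered_monoid_add}) interp)
        (\<pi>\<^sub>B :: ('r, 'b, 's) interp).
        finite (dom \<tau>) \<and> finite A \<and> A \<noteq> {} \<and> finite B \<and> B \<noteq> {} \<and>
        model_defining \<tau> A \<pi>\<^sub>A \<and> model_defining \<tau> B \<pi>\<^sub>B \<and>
        duplicator_wins \<tau> m A \<pi>\<^sub>A [] B \<pi>\<^sub>B [] \<longrightarrow>
        equiv_rank \<tau> m A \<pi>\<^sub>A [] B \<pi>\<^sub>B [])
     \<longleftrightarrow> (\<forall>s :: 's. s + s = s \<and> s * s = s)"
  (is "?sound \<longleftrightarrow> ?idem")
proof
  assume sound: ?sound
  show ?idem
  proof
    fix s :: 's
    show "s + s = s \<and> s * s = s"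
    \<comment> \<open>The interpretations below are model-defining only if \<open>s\<close> is
      nonzero; for zero both equations are trivial.\<close>
    proof (cases "s = 0")
      case False
      obtain b c :: 'b where "c \<noteq> b"
        using assms(3) by (metis ex_new_if_finite finite.emptyI finite_insert insertCI)
      define r :: 'r where "r = undefined"
      define a :: 'a where "a = undefined"
      let ?\<pi>\<^sub>A = "case_literal (\<lambda>_ _. s) (\<lambda>_ _. 0) :: ('r, 'a, 's) interp"
      let ?\<pi>\<^sub>B = "case_literal (\<lambda>_ _. s) (\<lambda>_ _. 0) :: ('r, 'b, 's) interp"
      have "equiv_rank [r \<mapsto> 1] 1 {a} ?\<pi>\<^sub>A [] {b, c} ?\<pi>\<^sub>B []"
        by (rule sound[rule_format])
          (use False duplicator_wins_one_round[of "{a}" "{b, c}" r s 0] in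
            \<open>simp add: model_defining_def\<close>)
      then have eval_eq: "eval {a} ?\<pi>\<^sub>A ((!) []) \<phi> = eval {b, c} ?\<pi>\<^sub>B ((!) []) \<phi>"
        if "formula_over [r \<mapsto> 1] \<phi>" "free_vars \<phi> = {}" "quantifier_rank \<phi> = 1" for \<phi>
        using that by (simp add: equiv_rank_def)
      \<comment> \<open>The one-element universe yields the left side, the two-element universe the
        right.\<close>
      have "s = s + s"
        using eval_eq[of "Exists 0 (Literal (Pos r [0]))"] \<open>c \<noteq> b\<close>
        by (simp add: Lit_def flip: mult_2)
      moreover have "s = s * s"
        using eval_eq[of "Forall 0 (Literal (Pos r [0]))"] \<open>c \<noteq> b\<close> by (simp add: Lit_def)
      ultimately show ?thesis by simp
    qed simp
  qed
next
  assume ?idem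
  \<comment> \<open>Sentences have no free variables, so the condition on the position map is
    vacuous and \<open>id\<close> is an arbitrary choice.\<close>
  then show ?sound
    by (auto simp: equiv_rank_def intro!: eval_eq_if_duplicator_wins[where p = id])
qed

end
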